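(* Let $(G,K)$ be a hypergroup Gelfand pair, let $\gamma:\widehat{G^\natural}\to\mathbb{R}_+=[0,\infty)$ be a measurable function and let $s>0$ be a real number. Then $H^{s,\natural}_\gamma(G)$ is continuously embedded in $L^{2,\natural}(G)$, with $$\|f\|_{L^{2,\natural}}\leqslant\|f\|_{H^{s,\natural}_\gamma}\qquad\text{for all } f\in H^{s,\natural}_\gamma(G),$$ where $\|\cdot\|_{L^{2,\natural}}$ is the $L^2(G)$-norm.
   Context: Hypergroups. Let $G$ be a locally compact Hausdorff space, $M(G)$ its Radon measures, $M_b(G)$ the bounded Radon measures, $\delta_x$ the point mass at $x$, and $\mathfrak{C}(G)$ the set of compact subspaces of $G$ with the Michael topology. $G$ is a hypergroup if: (1) there is a binary operation $\ast$ (convolution) turning $M_b(G)$ into an associative algebra such that $(\mu,\nu)\mapsto\mu\ast\nu$ is continuous for the cone topology (on nonnegative bounded measures, the weakest topology making $\mu\mapsto\int f\,d\mu$ continuous for $f=1$ and for every continuous compactly supported $f$), $\delta_x\ast\delta_y$ is a probability measure with compact support for all $x,y\in G$, and $(x,y)\mapsto\mathrm{supp}(\delta_x\ast\delta_y)$ is continuous from $G\times G$ to $\mathfrak{C}(G)$; (2) there is a unique $e\in G$ with $\delta_x\ast\delta_e=\delta_e\ast\delta_x=\delta_x$ for all $x$; (3) there is an involutive homeomorphism $x\mapsto x^\diamond$ of $G$ with $(\delta_x\ast\delta_y)^\diamond=\delta_{y^\diamond}\ast\delta_{x^\diamond}$, where $\mu^\diamond(f)=\mu(f^\diamond)$ and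 $f^\diamond(x)=f(x^\diamond)$; (4) $z\in\mathrm{supp}(\delta_x\ast\delta_y)\iff x\in\mathrm{supp}(\delta_z\ast\delta_{y^\diamond})$. A subhypergroup is a nonempty closed subset $H$ with $x^\diamond\in H$ and $\mathrm{supp}(\delta_x\ast\delta_y)\subset H$ for all $x,y\in H$. Write $f(x\ast y)=\int_G f\,d(\delta_x\ast\delta_y)$, and similarly for more factors; for measures, $(\mu\ast\nu)(f)=\int_G\int_G f(x\ast y)\,d\mu(x)\,d\nu(y)$. Gelfand pairs. $G$ is assumed to carry a left Haar measure $dx$ (a nonzero nonnegative Radon measure with $\int_G f(y\ast x)\,dx=\int_G f(x)\,dx$ for all $y\in G$ and all continuous compactly supported $f$), and $K$ is a compact subhypergroup of $G$ with normalized Haar measure $dk$. A function $f$ is $K$-bi-invariant if $f(k_1\ast x\ast k_2)=f(x)$ for all $k_1,k_2\in K$, $x\in G$ (for $L^p$ functions, understood almost everywhere in $x$). Put $f^\natural(x)=\int_K\int_K f(k_1\ast x\ast k_2)\,dk_1\,dk_2$; a measure $\mu$ is $K$-bi-invariant if $\mu(f^\natural)=\mu(f)$ for all continuous compactly supported $f$. $M_c^\natural(G)$ is the set of compactly supported $K$-bi-invariant complex Radon measures. $(G,K)$ is a (hypergroup) Gelfand pair if $(M_c^\natural(G),\ast)$ is commutative. Dual and Fourier transform. $\widehat{G^\natural}$ is the set of bounded continuous $K$-bi-invariant functions $\phi:G\to\mathbb{C}$ with $\phi(e)=1$, $\int_K\phi(x\ast k\ast y)\,dk=\phi(x)\phi(y)$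 and $\phi(x^\diamond)=\overline{\phi(x)}$ for all $x,y\in G$, with the topology of uniform convergence on compact sets (it is locally compact Hausdorff). For a $K$-bi-invariant integrable $f$, $\widehat f(\phi)=\int_G\phi(x^\diamond)f(x)\,dx$ for $\phi\in\widehat{G^\natural}$. $\pi$ denotes the Plancherel measure: the unique nonnegative measure on $\widehat{G^\natural}$ such that $\int_G|f(x)|^2dx=\int_{\widehat{G^\natural}}|\widehat f(\phi)|^2d\pi(\phi)$ for all $K$-bi-invariant $f\in L^1(G)\cap L^2(G)$. Let $L^{2,\natural}(G)$ be the space of $K$-bi-invariant functions in $L^2(G)$ and $L^2(\widehat{G^\natural})=L^2(\widehat{G^\natural},\pi)$. It is a known fact that the Fourier transform extends to an isometric isomorphism, still written $f\mapsto\widehat f$, from $L^{2,\natural}(G)$ onto $L^2(\widehat{G^\natural})$. Sobolev space. $H^{s,\natural}_\gamma(G)=\{f\in L^{2,\natural}(G):\int_{\widehat{G^\natural}}(1+\gamma(\phi)^2)^s|\widehat f(\phi)|^2d\pi(\phi)<\infty\}$, with norm $\|f\|_{H^{s,\natural}_\gamma}=\left(\int_{\widehat{G^\natural}}(1+\gamma(\phi)^2)^s|\widehat f(\phi)|^2d\pi(\phi)\right)^{1/2}$. *)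

theory Defs
  imports "HOL-Analysis.Analysis"
begin

section \<open>Radon measures\<close>

definition borel_of :: "'b topology \<Rightarrow> 'b measure" where
  "borel_of X = sigma (topspace X) {U. openin X U}"

lemma borel_of_euclidean: "borel_of (euclidean :: 'a::topological_space topology) = borel"
  by (simp add: borel_of_def borel_def)

text \<open>For a locally compact Hausdorff \<open>X\<close> these are the measures given by the Riesz
  representation theorem: locally finite, outer regular, and inner regular on open sets.\<close>

definition radon_measure :: "'b topology \<Rightarrow> 'b measure \<Rightarrow> bool" where
  "radon_measure X M \<longleftrightarrow>
     sets M = sets (borel_of X) \<and>
     (\<forall>C. compactin X C \<longrightarrow> emeasure M C < \<infinity>) \<and>
     (\<forall>A\<in>sets M. emeasure M A = (INF U\<in>{U. openin X U \<and> A \<subseteq> U}. emeasure M U)) \<and>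
     (\<forall>U. openin X U \<longrightarrow>
        emeasure M U = (SUP C\<in>{C. compactin X C \<and> C \<subseteq> U}. emeasure M C))"

text \<open>Complex measures are countably additive set functions on the Borel sets, extended by \<open>0\<close>
  to all other sets so that equality of measures is equality of functions. For a finite signed
  measure \<open>\<nu>\<close>, \<open>upper_variation \<nu>\<close> is the positive part of its Jordan decomposition.\<close>

type_synonym 'a cmeasure = "'a set \<Rightarrow> complex"

definition upper_variation :: "('a::topological_space set \<Rightarrow> real) \<Rightarrow> 'a measure" where
  "upper_variation \<nu> =
     measure_of UNIV (sets borel) (\<lambda>A. SUP B\<in>{B\<in>sets borel. B \<subseteq> A}. ennreal (\<nu> B))"

definition jordan_parts :: "'a::topological_space cmeasure \<Rightarrow> 'a measure list" where
  "jordan_parts \<mu> =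
     [upper_variation (\<lambda>A. Re (\<mu> A)), upper_variation (\<lambda>A. - Re (\<mu> A)),
      upper_variation (\<lambda>A. Im (\<mu> A)), upper_variation (\<lambda>A. - Im (\<mu> A))]"

definition cm_integrable :: "'a::topological_space cmeasure \<Rightarrow> ('a \<Rightarrow> complex) \<Rightarrow> bool" where
  "cm_integrable \<mu> f \<longleftrightarrow> (\<forall>M\<in>set (jordan_parts \<mu>). integrable M f)"

definition cm_integral :: "'a::topological_space cmeasure \<Rightarrow> ('a \<Rightarrow> complex) \<Rightarrow> complex" where
  "cm_integral \<mu> f =
     (LINT x|upper_variation (\<lambda>A. Re (\<mu> A)). f x) - (LINT x|upper_variation (\<lambda>A. - Re (\<mu> A)). f x)
     + \<i> * ((LINT x|upper_variation (\<lambda>A. Im (\<mu> A)). f x)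
           - (LINT x|upper_variation (\<lambda>A. - Im (\<mu> A)). f x))"

definition bounded_radon :: "'a::topological_space cmeasure set" where
  "bounded_radon = {\<mu>.
     (\<forall>A. A \<notin> sets borel \<longrightarrow> \<mu> A = 0) \<and>
     (\<forall>A. range A \<subseteq> sets borel \<and> disjoint_family A \<longrightarrow> (\<lambda>n::nat. \<mu> (A n)) sums \<mu> (\<Union>n. A n)) \<and>
     (\<forall>M\<in>set (jordan_parts \<mu>). radon_measure euclidean M)}"

definition nonneg_bounded_radon :: "'a::topological_space cmeasure set" where
  "nonneg_bounded_radon = {\<mu>\<in>bounded_radon. \<forall>A. \<mu> A \<in> \<real>\<^sub>\<ge>\<^sub>0}"

definition cm_support :: "'a::topological_space cmeasure \<Rightarrow> 'a set" where
  "cm_support \<mu> = {x. \<forall>U. open U \<and> x \<in> U \<longrightarrow> (\<exists>B\<in>sets borel. B \<subseteq> U \<and> \<mu> B \<noteq> 0)}"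

definition point_mass :: "'a::topological_space \<Rightarrow> 'a cmeasure" where
  "point_mass x = (\<lambda>A. if A \<in> sets borel \<and> x \<in> A then 1 else 0)"

text \<open>Continuous compactly supported functions on a subspace \<open>H\<close>, extended by \<open>0\<close>.\<close>

definition Cc :: "'a::topological_space set \<Rightarrow> ('a \<Rightarrow> complex) set" where
  "Cc H = {f. continuous_on H f \<and> (\<exists>C. compact C \<and> C \<subseteq> H \<and> (\<forall>x. x \<notin> C \<longrightarrow> f x = 0))}"

definition cone_topology :: "'a::topological_space cmeasure topology" where
  "cone_topology = topology_generated_by
     {{\<mu>\<in>nonneg_bounded_radon. cm_integral \<mu> f \<in> U} | f U. open U \<and> f \<in> insert (\<lambda>x. 1) (Cc UNIV)}"

text \<open>The points of this space are the nonempty compact sets.\<close>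

definition michael_topology :: "'a::topological_space set topology" where
  "michael_topology = topology_generated_by
     {{C. compact C \<and> C \<inter> U \<noteq> {} \<and> C \<subseteq> V} | U V. open U \<and> open V}"

section \<open>Hypergroups\<close>

text \<open>In \<open>inv_conv\<close> below, the measure $\mu^\diamond$ with $\mu^\diamond(f) = \mu(f^\diamond)$ is the image
  of \<open>\<mu>\<close> under the involution.\<close>

locale hypergroup =
  fixes conv :: "'a::t2_space cmeasure \<Rightarrow> 'a cmeasure \<Rightarrow> 'a cmeasure"
    and e :: 'a
    and invol :: "'a \<Rightarrow> 'a"
  assumes locally_compact: "locally_compact_space (euclidean :: 'a topology)"
    and conv_closed:
      "\<lbrakk>\<mu> \<in> bounded_radon; \<nu> \<in> bounded_radon\<rbrakk> \<Longrightarrow> conv \<mu> \<nu> \<in> bounded_radon"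
    and conv_linear_left:
      "\<lbrakk>\<mu> \<in> bounded_radon; \<mu>' \<in> bounded_radon; \<nu> \<in> bounded_radon\<rbrakk> \<Longrightarrow>
        conv (\<lambda>A. a * \<mu> A + b * \<mu>' A) \<nu> = (\<lambda>A. a * conv \<mu> \<nu> A + b * conv \<mu>' \<nu> A)"
    and conv_linear_right:
      "\<lbrakk>\<mu> \<in> bounded_radon; \<nu> \<in> bounded_radon; \<nu>' \<in> bounded_radon\<rbrakk> \<Longrightarrow>
        conv \<mu> (\<lambda>A. a * \<nu> A + b * \<nu>' A) = (\<lambda>A. a * conv \<mu> \<nu> A + b * conv \<mu> \<nu>' A)"
    and conv_assoc:
      "\<lbrakk>\<mu> \<in> bounded_radon; \<nu> \<in> bounded_radon; \<rho> \<in> bounded_radon\<rbrakk> \<Longrightarrow>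
        conv (conv \<mu> \<nu>) \<rho> = conv \<mu> (conv \<nu> \<rho>)"
    and conv_continuous:
      "continuous_map (prod_topology cone_topology cone_topology) cone_topology
         (\<lambda>(\<mu>, \<nu>). conv \<mu> \<nu>)"
    and conv_point_mass_nonneg: "conv (point_mass x) (point_mass y) \<in> nonneg_bounded_radon"
    and conv_point_mass_total: "conv (point_mass x) (point_mass y) UNIV = 1"
    and conv_point_mass_compact_support:
      "compact (cm_support (conv (point_mass x) (point_mass y)))"
    and support_continuous:
      "continuous_map euclidean michael_topology
         (\<lambda>(x, y). cm_support (conv (point_mass x) (point_mass y)))"
    and unit:
      "conv (point_mass x) (point_mass e) = point_mass x"
      "conv (point_mass e) (point_mass x) = point_mass x"
    and unit_unique:
      "(\<And>x. conv (point_mass x) (point_mass e') = point_mass x \<and>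
             conv (point_mass e') (point_mass x) = point_mass x) \<Longrightarrow> e' = e"
    and involutive: "invol (invol x) = x"
    and inv_homeomorphism: "homeomorphism UNIV UNIV invol invol"
    and inv_conv:
      "(\<lambda>A. conv (point_mass x) (point_mass y) (invol -` A))
         = conv (point_mass (invol y)) (point_mass (invol x))"
    and support_inv:
      "z \<in> cm_support (conv (point_mass x) (point_mass y)) \<longleftrightarrow>
       x \<in> cm_support (conv (point_mass z) (point_mass (invol y)))"

definition subhypergroup ::
    "('a::t2_space cmeasure \<Rightarrow> 'a cmeasure \<Rightarrow> 'a cmeasure) \<Rightarrow> ('a \<Rightarrow> 'a) \<Rightarrow> 'a set \<Rightarrow> bool" where
  "subhypergroup conv invol H \<longleftrightarrow> H \<noteq> {} \<and> closed H \<and> (\<forall>x\<in>H. invol x \<in> H) \<and>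
     (\<forall>x\<in>H. \<forall>y\<in>H. cm_support (conv (point_mass x) (point_mass y)) \<subseteq> H)"

text \<open>\<open>eval2 conv f x y\<close> is $f(x \ast y)$ and \<open>eval3 conv f x y z\<close> is $f(x \ast y \ast z)$.\<close>

definition eval2 ::
    "('a::t2_space cmeasure \<Rightarrow> 'a cmeasure \<Rightarrow> 'a cmeasure) \<Rightarrow> ('a \<Rightarrow> complex) \<Rightarrow> 'a \<Rightarrow> 'a \<Rightarrow> complex"
  where "eval2 conv f x y = cm_integral (conv (point_mass x) (point_mass y)) f"

definition eval3 ::
    "('a::t2_space cmeasure \<Rightarrow> 'a cmeasure \<Rightarrow> 'a cmeasure) \<Rightarrow> ('a \<Rightarrow> complex) \<Rightarrow>
     'a \<Rightarrow> 'a \<Rightarrow> 'a \<Rightarrow> complex"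
  where "eval3 conv f x y z =
    cm_integral (conv (conv (point_mass x) (point_mass y)) (point_mass z)) f"

text \<open>Left Haar measures of a subhypergroup \<open>H\<close>, as measures on the space \<open>H\<close>;
  \<open>H = UNIV\<close> is the hypergroup itself.\<close>

definition left_haar_measure ::
    "('a::t2_space cmeasure \<Rightarrow> 'a cmeasure \<Rightarrow> 'a cmeasure) \<Rightarrow> 'a set \<Rightarrow> 'a measure \<Rightarrow> bool" where
  "left_haar_measure conv H m \<longleftrightarrow>
     radon_measure (top_of_set H) m \<and> emeasure m H \<noteq> 0 \<and>
     (\<forall>y\<in>H. \<forall>f\<in>Cc H. (LINT x|m. eval2 conv f y x) = (LINT x|m. f x))"

section \<open>Gelfand pairs\<close>

definition natural_proj ::
    "('a::t2_space cmeasure \<Rightarrow> 'a cmeasure \<Rightarrow> 'a cmeasure) \<Rightarrow> 'a measure \<Rightarrow>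
     ('a \<Rightarrow> complex) \<Rightarrow> 'a \<Rightarrow> complex" where
  "natural_proj conv \<kappa> f x = (LINT k2|\<kappa>. (LINT k1|\<kappa>. eval3 conv f k1 x k2))"

definition biinvariant_compact_measures ::
    "('a::t2_space cmeasure \<Rightarrow> 'a cmeasure \<Rightarrow> 'a cmeasure) \<Rightarrow> 'a measure \<Rightarrow> 'a cmeasure set" where
  "biinvariant_compact_measures conv \<kappa> =
     {\<mu>\<in>bounded_radon. compact (cm_support \<mu>) \<and>
        (\<forall>f\<in>Cc UNIV. cm_integral \<mu> (natural_proj conv \<kappa> f) = cm_integral \<mu> f)}"

locale hypergroup_gelfand_pair = hypergroup conv e invol
  for conv :: "'a::t2_space cmeasure \<Rightarrow> 'a cmeasure \<Rightarrow> 'a cmeasure"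
    and e :: 'a
    and invol :: "'a \<Rightarrow> 'a" +
  fixes m :: "'a measure"
    and K :: "'a set"
    and \<kappa> :: "'a measure"
  assumes haar: "left_haar_measure conv UNIV m"
    and subhypergroup: "subhypergroup conv invol K"
    and compact: "compact K"
    and haar_K: "left_haar_measure conv K \<kappa>"
    and haar_K_normalized: "emeasure \<kappa> K = 1"
    and commutative:
      "\<lbrakk>\<mu> \<in> biinvariant_compact_measures conv \<kappa>; \<nu> \<in> biinvariant_compact_measures conv \<kappa>\<rbrakk>
        \<Longrightarrow> conv \<mu> \<nu> = conv \<nu> \<mu>"

definition biinvariant ::
    "('a::t2_space cmeasure \<Rightarrow> 'a cmeasure \<Rightarrow> 'a cmeasure) \<Rightarrow> 'a set \<Rightarrow> ('a \<Rightarrow> complex) \<Rightarrow> bool" where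
  "biinvariant conv K f \<longleftrightarrow> (\<forall>k1\<in>K. \<forall>k2\<in>K. \<forall>x. eval3 conv f k1 x k2 = f x)"

text \<open>Here the existence of the integral defining $f(k_1 \ast x \ast k_2)$ has to be part of the
  condition, since the Bochner integral of a non-integrable function is \<open>0\<close> by convention.\<close>

definition biinvariant_ae ::
    "('a::t2_space cmeasure \<Rightarrow> 'a cmeasure \<Rightarrow> 'a cmeasure) \<Rightarrow> 'a measure \<Rightarrow> 'a set \<Rightarrow>
     ('a \<Rightarrow> complex) \<Rightarrow> bool" where
  "biinvariant_ae conv m K f \<longleftrightarrow> (\<forall>k1\<in>K. \<forall>k2\<in>K. AE x in m.
     cm_integrable (conv (conv (point_mass k1) (point_mass x)) (point_mass k2)) f \<and>
     eval3 conv f k1 x k2 = f x)"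

section \<open>Dual space and Fourier transform\<close>

definition dual_space ::
    "('a::t2_space cmeasure \<Rightarrow> 'a cmeasure \<Rightarrow> 'a cmeasure) \<Rightarrow> 'a \<Rightarrow> ('a \<Rightarrow> 'a) \<Rightarrow> 'a set \<Rightarrow>
     'a measure \<Rightarrow> ('a \<Rightarrow> complex) set" where
  "dual_space conv e invol K \<kappa> = {\<phi>.
     continuous_on UNIV \<phi> \<and> bounded (range \<phi>) \<and> biinvariant conv K \<phi> \<and> \<phi> e = 1 \<and>
     (\<forall>x y. (LINT k|\<kappa>. eval3 conv \<phi> x k y) = \<phi> x * \<phi> y) \<and>
     (\<forall>x. \<phi> (invol x) = cnj (\<phi> x))}"

definition dual_topology ::
    "('a::t2_space cmeasure \<Rightarrow> 'a cmeasure \<Rightarrow> 'a cmeasure) \<Rightarrow> 'a \<Rightarrow> ('a \<Rightarrow> 'a) \<Rightarrow> 'a set \<Rightarrow>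
     'a measure \<Rightarrow> ('a \<Rightarrow> complex) topology" where
  "dual_topology conv e invol K \<kappa> = topology_generated_by
     {{\<psi>\<in>dual_space conv e invol K \<kappa>. \<forall>x\<in>C. cmod (\<psi> x - \<phi> x) < \<epsilon>} | \<phi> C \<epsilon>.
        \<phi> \<in> dual_space conv e invol K \<kappa> \<and> compact C \<and> 0 < \<epsilon>}"

lemma topspace_dual_topology:
  "topspace (dual_topology conv e invol K \<kappa>) = dual_space conv e invol K \<kappa>" (is "_ = ?D")
proof -
  have "\<phi> \<in> topspace (dual_topology conv e invol K \<kappa>)" if "\<phi> \<in> ?D" for \<phi>
  proof -
    have "\<phi> \<in> {\<psi>\<in>?D. \<forall>x\<in>{}. cmod (\<psi> x - \<phi> x) < 1}" using that by simp
    then show ?thesis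
      unfolding dual_topology_def topology_generated_by_topspace using that
      by (intro UnionI CollectI exI[of _ \<phi>] exI[of _ "{}"] exI[of _ 1] conjI) auto
  qed
  then show ?thesis
    by (auto simp: dual_topology_def)
qed

text \<open>Elements of $L^2$ are represented by functions; equality in $L^2$ is equality almost
  everywhere.\<close>

definition L2 :: "'b measure \<Rightarrow> ('b \<Rightarrow> complex) set" where
  "L2 M = {f \<in> borel_measurable M. integrable M (\<lambda>x. (cmod (f x))\<^sup>2)}"

definition L2_norm :: "'b measure \<Rightarrow> ('b \<Rightarrow> complex) \<Rightarrow> real" where
  "L2_norm M f = sqrt (LINT x|M. (cmod (f x))\<^sup>2)"

definition L2_nat ::
    "('a::t2_space cmeasure \<Rightarrow> 'a cmeasure \<Rightarrow> 'a cmeasure) \<Rightarrow> 'a measure \<Rightarrow> 'a set \<Rightarrow>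
     ('a \<Rightarrow> complex) set" where
  "L2_nat conv m K = {f \<in> L2 m. biinvariant_ae conv m K f}"

definition fourier ::
    "('a \<Rightarrow> 'a) \<Rightarrow> 'a measure \<Rightarrow> ('a \<Rightarrow> complex) \<Rightarrow> ('a \<Rightarrow> complex) \<Rightarrow> complex" where
  "fourier invol m f \<phi> = (LINT x|m. \<phi> (invol x) * f x)"

definition plancherel_measure ::
    "('a::t2_space cmeasure \<Rightarrow> 'a cmeasure \<Rightarrow> 'a cmeasure) \<Rightarrow> 'a \<Rightarrow> ('a \<Rightarrow> 'a) \<Rightarrow> 'a measure \<Rightarrow>
     'a set \<Rightarrow> 'a measure \<Rightarrow> ('a \<Rightarrow> complex) measure \<Rightarrow> bool" where
  "plancherel_measure conv e invol m K \<kappa> \<pi> \<longleftrightarrow>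
     radon_measure (dual_topology conv e invol K \<kappa>) \<pi> \<and>
     (\<forall>f\<in>L2_nat conv m K. integrable m f \<longrightarrow>
        (\<integral>\<^sup>+x. ennreal ((cmod (f x))\<^sup>2) \<partial>m) = (\<integral>\<^sup>+\<phi>. ennreal ((cmod (fourier invol m f \<phi>))\<^sup>2) \<partial>\<pi>))"

text \<open>\<open>F\<close> is the extension of the Fourier transform to an isometric isomorphism from
  $L^{2,\natural}(G)$ onto $L^2(\pi)$. It is unique (up to null functions) because the integrable
  functions are dense in $L^{2,\natural}(G)$.\<close>

definition plancherel_transform ::
    "('a::t2_space cmeasure \<Rightarrow> 'a cmeasure \<Rightarrow> 'a cmeasure) \<Rightarrow> ('a \<Rightarrow> 'a) \<Rightarrow> 'a measure \<Rightarrow> 'a set \<Rightarrow>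
     ('a \<Rightarrow> complex) measure \<Rightarrow> (('a \<Rightarrow> complex) \<Rightarrow> ('a \<Rightarrow> complex) \<Rightarrow> complex) \<Rightarrow> bool" where
  "plancherel_transform conv invol m K \<pi> F \<longleftrightarrow>
     (\<forall>f\<in>L2_nat conv m K. F f \<in> L2 \<pi>) \<and>
     (\<forall>f\<in>L2_nat conv m K. integrable m f \<longrightarrow> (AE \<phi> in \<pi>. F f \<phi> = fourier invol m f \<phi>)) \<and>
     (\<forall>f\<in>L2_nat conv m K. \<forall>g\<in>L2_nat conv m K. \<forall>a b.
        AE \<phi> in \<pi>. F (\<lambda>x. a * f x + b * g x) \<phi> = a * F f \<phi> + b * F g \<phi>) \<and>
     (\<forall>f\<in>L2_nat conv m K. L2_norm \<pi> (F f) = L2_norm m f) \<and>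
     (\<forall>h\<in>L2 \<pi>. \<exists>f\<in>L2_nat conv m K. AE \<phi> in \<pi>. F f \<phi> = h \<phi>)"

section \<open>Sobolev spaces\<close>

definition sobolev ::
    "('a::t2_space cmeasure \<Rightarrow> 'a cmeasure \<Rightarrow> 'a cmeasure) \<Rightarrow> 'a measure \<Rightarrow> 'a set \<Rightarrow>
     ('a \<Rightarrow> complex) measure \<Rightarrow> (('a \<Rightarrow> complex) \<Rightarrow> ('a \<Rightarrow> complex) \<Rightarrow> complex) \<Rightarrow>
     (('a \<Rightarrow> complex) \<Rightarrow> real) \<Rightarrow> real \<Rightarrow> ('a \<Rightarrow> complex) set" where
  "sobolev conv m K \<pi> F \<gamma> s =
     {f \<in> L2_nat conv m K. integrable \<pi> (\<lambda>\<phi>. (1 + (\<gamma> \<phi>)\<^sup>2) powr s * (cmod (F f \<phi>))\<^sup>2)}"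

definition sobolev_norm ::
    "('a \<Rightarrow> complex) measure \<Rightarrow> (('a \<Rightarrow> complex) \<Rightarrow> ('a \<Rightarrow> complex) \<Rightarrow> complex) \<Rightarrow>
     (('a \<Rightarrow> complex) \<Rightarrow> real) \<Rightarrow> real \<Rightarrow> ('a \<Rightarrow> complex) \<Rightarrow> real" where
  "sobolev_norm \<pi> F \<gamma> s f =
     sqrt (LINT \<phi>|\<pi>. (1 + (\<gamma> \<phi>)\<^sup>2) powr s * (cmod (F f \<phi>))\<^sup>2)"

text \<open>The inclusion of \<open>V\<close> into \<open>W\<close> is a continuous injective linear map. The norms \<open>p\<close> and \<open>q\<close>
  are only seminorms on functions, so injectivity is stated for the spaces of functions modulo
  null functions; that null functions of \<open>V\<close> are null in \<open>W\<close> follows from continuity.\<close>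

definition continuously_embedded ::
    "('a \<Rightarrow> complex) set \<Rightarrow> (('a \<Rightarrow> complex) \<Rightarrow> real) \<Rightarrow>
     ('a \<Rightarrow> complex) set \<Rightarrow> (('a \<Rightarrow> complex) \<Rightarrow> real) \<Rightarrow> bool" where
  "continuously_embedded V p W q \<longleftrightarrow>
     V \<subseteq> W \<and> (\<lambda>x. 0) \<in> V \<and>
     (\<forall>f\<in>V. \<forall>g\<in>V. \<forall>a b. (\<lambda>x. a * f x + b * g x) \<in> V) \<and>
     (\<forall>f\<in>V. q f = 0 \<longrightarrow> p f = 0) \<and>
     (\<forall>f\<in>V. \<forall>\<epsilon>>0. \<exists>\<delta>>0. \<forall>g\<in>V. p (\<lambda>x. g x - f x) < \<delta> \<longrightarrow> q (\<lambda>x. g x - f x) < \<epsilon>)"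

end

theory Submission
  imports Defs
begin

text \<open>Since s > 0 and 1 + \<gamma>(\<phi>)^2 is at least 1, the Sobolev weight is at least 1
  at every \<phi>. The Plancherel isometry turns the L^2 norm of f into that of \<open>F f\<close>,
  and inserting the weight can only increase the integral; this is the norm inequality. Continuity
  of the inclusion follows from it by linearity. What remains is bookkeeping with representatives:
  \<open>F\<close> is linear only up to null functions, so closure of the Sobolev space under linear
  combinations and membership of 0 are almost-everywhere arguments.
  \<open>integrable_weighted_cmod_power2_lincomb\<close> gives the closure, and
  \<open>L2_norm_eq_0_iff\<close> turns the isometry into vanishing of the transform.\<close>

lemma cmod_lincomb_power2_le:
  fixes a b x y :: complex
  shows "(cmod (a * x + b * y))\<^sup>2 \<le> 2 * (cmod a)\<^sup>2 * (cmod x)\<^sup>2 + 2 * (cmod b)\<^sup>2 * (cmod y)\<^sup>2"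
proof -
  have "cmod (a * x + b * y) \<le> cmod a * cmod x + cmod b * cmod y"
    by (metis norm_mult norm_triangle_ineq)
  then have "(cmod (a * x + b * y))\<^sup>2 \<le> (cmod a * cmod x + cmod b * cmod y)\<^sup>2"
    by (simp add: power_mono)
  also have "\<dots> \<le> 2 * (cmod a * cmod x)\<^sup>2 + 2 * (cmod b * cmod y)\<^sup>2"
    using sum_squares_bound[of "cmod a * cmod x" "cmod b * cmod y"]
    by (simp add: power2_sum)
  finally show ?thesis
    by (simp add: power_mult_distrib mult.assoc)
qed

text \<open>Domination by the weighted form of the preceding inequality. The identity for
  \<open>h\<close> is asked only almost everywhere because it will be applied to \<open>F\<close> of
  a linear combination; measurability of \<open>h\<close> is then a separate assumption, as a null
  modification may destroy it.\<close>

lemma integrable_weighted_cmod_power2_lincomb: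
  fixes f g h :: "'b \<Rightarrow> complex" and w :: "'b \<Rightarrow> real"
  assumes [measurable]: "h \<in> borel_measurable M" "w \<in> borel_measurable M"
    and w: "\<And>x. 0 \<le> w x"
    and f: "integrable M (\<lambda>x. w x * (cmod (f x))\<^sup>2)"
    and g: "integrable M (\<lambda>x. w x * (cmod (g x))\<^sup>2)"
    and h: "AE x in M. h x = a * f x + b * g x"
  shows "integrable M (\<lambda>x. w x * (cmod (h x))\<^sup>2)"
proof (rule Bochner_Integration.integrable_bound)
  show "integrable M (\<lambda>x. 2 * (cmod a)\<^sup>2 * (w x * (cmod (f x))\<^sup>2)
                        + 2 * (cmod b)\<^sup>2 * (w x * (cmod (g x))\<^sup>2))"
    using f g by simp
  show "AE x in M. norm (w x * (cmod (h x))\<^sup>2)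
      \<le> norm (2 * (cmod a)\<^sup>2 * (w x * (cmod (f x))\<^sup>2) + 2 * (cmod b)\<^sup>2 * (w x * (cmod (g x))\<^sup>2))"
    using h
  proof eventually_elim
    case (elim x)
    show ?case
      using mult_left_mono[OF cmod_lincomb_power2_le[of a "f x" b "g x"] w[of x]] w[of x] elim
      by (simp add: algebra_simps)
  qed
qed simp

lemma L2_lincomb:
  assumes "f \<in> L2 M" "g \<in> L2 M"
  shows "(\<lambda>x. a * f x + b * g x) \<in> L2 M"
proof -
  have f: "f \<in> borel_measurable M" and g: "g \<in> borel_measurable M"
    using assms by (auto simp: L2_def)
  then have h: "(\<lambda>x. a * f x + b * g x) \<in> borel_measurable M"
    by measurable
  show ?thesis
    \<comment> \<open>Plain square integrability is the case of constant weight 1.\<close>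
    using h integrable_weighted_cmod_power2_lincomb[OF h, of "\<lambda>_. 1" f g a b] assms
    by (simp add: L2_def)
qed

lemma cm_integrable_zero: "cm_integrable \<mu> (\<lambda>x. 0)"
  by (simp add: cm_integrable_def)

lemma cm_integrable_lincomb:
  assumes "cm_integrable \<mu> f" "cm_integrable \<mu> g"
  shows "cm_integrable \<mu> (\<lambda>x. a * f x + b * g x)"
  using assms by (simp add: cm_integrable_def)

lemma cm_integral_lincomb:
  assumes "cm_integrable \<mu> f" "cm_integrable \<mu> g"
  shows "cm_integral \<mu> (\<lambda>x. a * f x + b * g x) = a * cm_integral \<mu> f + b * cm_integral \<mu> g"
  using assms by (simp add: cm_integrable_def cm_integral_def jordan_parts_def algebra_simps)

text \<open>For each fixed pair \<open>k1\<close>, \<open>k2\<close> the two exceptional null sets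
  are united. Off them both functions are integrable against the convolved point masses, which is
  what makes \<open>cm_integral\<close> additive there.\<close>

lemma biinvariant_ae_lincomb:
  assumes "biinvariant_ae conv m K f" "biinvariant_ae conv m K g"
  shows "biinvariant_ae conv m K (\<lambda>x. a * f x + b * g x)"
  unfolding biinvariant_ae_def
proof (intro ballI)
  fix k1 k2 assume k: "k1 \<in> K" "k2 \<in> K"
  let ?\<mu> = "\<lambda>x. conv (conv (point_mass k1) (point_mass x)) (point_mass k2)"
  have "AE x in m. cm_integrable (?\<mu> x) f \<and> eval3 conv f k1 x k2 = f x"
    and "AE x in m. cm_integrable (?\<mu> x) g \<and> eval3 conv g k1 x k2 = g x"
    using assms k by (auto simp: biinvariant_ae_def)
  then show "AE x in m. cm_integrable (?\<mu> x) (\<lambda>x. a * f x + b * g x)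
      \<and> eval3 conv (\<lambda>x. a * f x + b * g x) k1 x k2 = a * f x + b * g x"
    by eventually_elim (auto simp: eval3_def cm_integrable_lincomb cm_integral_lincomb)
qed

lemma L2_nat_lincomb:
  assumes "f \<in> L2_nat conv m K" "g \<in> L2_nat conv m K"
  shows "(\<lambda>x. a * f x + b * g x) \<in> L2_nat conv m K"
  using assms by (simp add: L2_nat_def L2_lincomb biinvariant_ae_lincomb)

lemma zero_in_L2_nat: "(\<lambda>x. 0) \<in> L2_nat conv m K"
  by (simp add: L2_nat_def L2_def biinvariant_ae_def eval3_def cm_integrable_zero cm_integral_def)

lemma L2_norm_eq_0_iff:
  assumes "f \<in> L2 M"
  shows "L2_norm M f = 0 \<longleftrightarrow> (AE x in M. f x = 0)"
  using assms integral_nonneg_eq_0_iff_AE[of M "\<lambda>x. (cmod (f x))\<^sup>2"]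
  by (simp add: L2_def L2_norm_def)

theorem theorem3p4:
  fixes conv :: "'a::t2_space cmeasure \<Rightarrow> 'a cmeasure \<Rightarrow> 'a cmeasure"
    and e :: 'a
    and invol :: "'a \<Rightarrow> 'a"
    and m :: "'a measure"
    and K :: "'a set"
    and \<kappa> :: "'a measure"
    and \<pi> :: "('a \<Rightarrow> complex) measure"
    and F :: "('a \<Rightarrow> complex) \<Rightarrow> ('a \<Rightarrow> complex) \<Rightarrow> complex"
    and \<gamma> :: "('a \<Rightarrow> complex) \<Rightarrow> real"
    and s :: real
  assumes "hypergroup_gelfand_pair conv e invol m K \<kappa>"
    and "plancherel_measure conv e invol m K \<kappa> \<pi>"
    and "plancherel_transform conv invol m K \<pi> F"
    and "\<gamma> \<in> borel_measurable (borel_of (dual_topology conv e invol K \<kappa>))"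
    and "\<And>\<phi>. \<phi> \<in> dual_space conv e invol K \<kappa> \<Longrightarrow> 0 \<le> \<gamma> \<phi>"
    and "0 < s"
  shows "continuously_embedded (sobolev conv m K \<pi> F \<gamma> s) (sobolev_norm \<pi> F \<gamma> s)
           (L2_nat conv m K) (L2_norm m)
         \<and> (\<forall>f\<in>sobolev conv m K \<pi> F \<gamma> s. L2_norm m f \<le> sobolev_norm \<pi> F \<gamma> s f)"
proof -
  let ?V = "sobolev conv m K \<pi> F \<gamma> s"
  let ?p = "sobolev_norm \<pi> F \<gamma> s"
  let ?N = "L2_nat conv m K"
  let ?w = "\<lambda>\<phi>. (1 + (\<gamma> \<phi>)\<^sup>2) powr s"
  note T = assms(3)[unfolded plancherel_transform_def]
  have F_L2: "F f \<in> L2 \<pi>" and F_iso: "L2_norm \<pi> (F f) = L2_norm m f" if "f \<in> ?N" for f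
    using T that by auto
  have F_lincomb: "AE \<phi> in \<pi>. F (\<lambda>x. a * f x + b * g x) \<phi> = a * F f \<phi> + b * F g \<phi>"
    if "f \<in> ?N" "g \<in> ?N" for f g a b
    using T that by blast
  have sets: "sets \<pi> = sets (borel_of (dual_topology conv e invol K \<kappa>))"
    using assms(2) by (simp add: plancherel_measure_def radon_measure_def)
  \<comment> \<open>As a Radon measure for the dual topology, \<open>\<pi>\<close> lives on exactly
    the Borel sets for which \<open>\<gamma>\<close> is measurable.\<close>
  have "\<gamma> \<in> borel_measurable \<pi>"
    using assms(4) measurable_cong_sets[OF sets refl] by blast
  then have w_meas: "?w \<in> borel_measurable \<pi>"
    by measurable
  have w_ge_1: "1 \<le> ?w \<phi>" for \<phi>
    using assms(6) by (simp add: ge_one_powr_ge_zero)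
  have lincomb: "(\<lambda>x. a * f x + b * g x) \<in> ?V" if "f \<in> ?V" "g \<in> ?V" for f g a b
  proof -
    from that have N: "f \<in> ?N" "g \<in> ?N"
      by (auto simp: sobolev_def)
    have "integrable \<pi> (\<lambda>\<phi>. ?w \<phi> * (cmod (F (\<lambda>x. a * f x + b * g x) \<phi>))\<^sup>2)"
    proof (rule integrable_weighted_cmod_power2_lincomb)
      show "F (\<lambda>x. a * f x + b * g x) \<in> borel_measurable \<pi>"
        using F_L2[OF L2_nat_lincomb[OF N]] by (simp add: L2_def)
      show "AE \<phi> in \<pi>. F (\<lambda>x. a * f x + b * g x) \<phi> = a * F f \<phi> + b * F g \<phi>"
        by (rule F_lincomb[OF N])
    qed (use that w_meas in \<open>auto simp: sobolev_def\<close>)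
    then show ?thesis
      using L2_nat_lincomb[OF N] by (simp add: sobolev_def)
  qed
  \<comment> \<open>By the isometry \<open>F f\<close> is a null function, and a finite weight keeps
    it null. This serves twice: for the zero function and for injectivity of the embedding.\<close>
  have vanish: "AE \<phi> in \<pi>. ?w \<phi> * (cmod (F f \<phi>))\<^sup>2 = 0" if "f \<in> ?N" "L2_norm m f = 0" for f
  proof -
    have "AE \<phi> in \<pi>. F f \<phi> = 0"
      using that F_iso L2_norm_eq_0_iff[OF F_L2] by simp
    then show ?thesis
      by eventually_elim simp
  qed
  \<comment> \<open>\<open>F\<close> acts on representatives, so \<open>F\<close> of the zero
    function is zero only almost everywhere; integrability is transferred from the constant
    0.\<close>
  have zero: "(\<lambda>x. 0) \<in> ?V"
  proof -
    have "AE \<phi> in \<pi>. ?w \<phi> * (cmod (F (\<lambda>x. 0) \<phi>))\<^sup>2 = 0"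
      by (rule vanish[OF zero_in_L2_nat]) (simp add: L2_norm_def)
    moreover have "F (\<lambda>x. 0) \<in> borel_measurable \<pi>"
      using F_L2[OF zero_in_L2_nat] by (simp add: L2_def)
    ultimately have "integrable \<pi> (\<lambda>\<phi>. ?w \<phi> * (cmod (F (\<lambda>x. 0) \<phi>))\<^sup>2)"
      using w_meas by (subst integrable_cong_AE[where g = "\<lambda>_. 0"]) auto
    then show ?thesis
      by (simp add: sobolev_def zero_in_L2_nat)
  qed
  have bound: "L2_norm m f \<le> ?p f" if "f \<in> ?V" for f
  proof -
    from that have N: "f \<in> ?N" and int: "integrable \<pi> (\<lambda>\<phi>. ?w \<phi> * (cmod (F f \<phi>))\<^sup>2)"
      by (auto simp: sobolev_def)
    have "(LINT \<phi>|\<pi>. (cmod (F f \<phi>))\<^sup>2) \<le> (LINT \<phi>|\<pi>. ?w \<phi> * (cmod (F f \<phi>))\<^sup>2)"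
    proof (rule integral_mono[OF _ int])
      show "integrable \<pi> (\<lambda>\<phi>. (cmod (F f \<phi>))\<^sup>2)"
        using F_L2[OF N] by (simp add: L2_def)
      show "(cmod (F f \<phi>))\<^sup>2 \<le> ?w \<phi> * (cmod (F f \<phi>))\<^sup>2" for \<phi>
        using mult_right_mono[OF w_ge_1[of \<phi>], of "(cmod (F f \<phi>))\<^sup>2"] by simp
    qed
    then have "L2_norm \<pi> (F f) \<le> ?p f"
      by (simp add: L2_norm_def sobolev_norm_def)
    then show ?thesis
      by (simp add: F_iso[OF N])
  qed
  have "?p f = 0" if "f \<in> ?V" "L2_norm m f = 0" for f
    using integral_eq_zero_AE[OF vanish[of f]] that by (simp add: sobolev_norm_def sobolev_def)
  moreover have "\<exists>\<delta>>0. \<forall>g\<in>?V. ?p (\<lambda>x. g x - f x) < \<delta> \<longrightarrow> L2_norm m (\<lambda>x. g x - f x) < \<epsilon>"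
    if "f \<in> ?V" "0 < \<epsilon>" for f \<epsilon>
  \<comment> \<open>The inclusion does not increase norms, so \<delta> = \<epsilon> works once the
    difference is known to lie in the Sobolev space.\<close>
  proof (intro exI[of _ \<epsilon>] conjI ballI impI)
    fix g assume "g \<in> ?V" and small: "?p (\<lambda>x. g x - f x) < \<epsilon>"
    then have "(\<lambda>x. g x - f x) \<in> ?V"
      using lincomb[of g f 1 "-1"] that by simp
    from bound[OF this] small show "L2_norm m (\<lambda>x. g x - f x) < \<epsilon>"
      by simp
  qed (rule that)
  moreover have "?V \<subseteq> ?N"
    by (auto simp: sobolev_def)
  ultimately show ?thesis
    using lincomb zero bound by (auto simp: continuously_embedded_def)
qed

end
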